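(* The generalized graph shift operation on an arbitrary graph increases the spectral radius: if $G_1$ and $G_2$ are simple connected graphs with $n$ vertices such that $G_2=\mathrm{GGS}(G_1)$, then $\sigma(G_1)\le\sigma(G_2)$.
   Context: $\sigma(G)$ denotes the spectral radius of a graph $G$, i.e. the largest eigenvalue of its adjacency matrix. Generalized graph shift (GGS): let $G_1$ be a graph and let $u$ and $w$ be two distinct vertices of $G_1$ connected by a path $P$ from $u$ to $w$ such that (1) every interior vertex of $P$ (if any) has degree 2 in $G_1$, and (2) $u$ and $w$ are not both contained in one cycle of $G_1$. Let $w'$ be the neighbour of $w$ on $P$. Then $G_2=\mathrm{GGS}(G_1)$ is obtained from $G_1$ by moving all neighbours of $w$ except $w'$ to $u$, i.e. for each neighbour $z\ne w'$ of $w$, the edge $\{w,z\}$ is deleted and the edge $\{u,z\}$ is added. *)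

theory Defs
  imports "Graph_Theory.Graph_Theory" "Jordan_Normal_Form.Char_Poly"
begin

text \<open>
  A finite simple undirected graph is a symmetric loop-free pair digraph (locale
  \<^locale>\<open>pair_graph\<close>): the edge \<open>{a, b}\<close> is represented by the two arcs \<open>(a, b)\<close> and \<open>(b, a)\<close>.
\<close>

definition adj_matrix :: "'a pair_pre_digraph \<Rightarrow> 'a list \<Rightarrow> real mat" where
  "adj_matrix G vs =
     mat (length vs) (length vs) (\<lambda>(i, j). if (vs ! i, vs ! j) \<in> parcs G then 1 else 0)"

text \<open>
  The eigenvalues of a graph do not depend on the enumeration \<open>vs\<close> of its vertices; see
  \<open>graph_eigenvalues_eq\<close> below.  They are real since the adjacency matrix of an undirected
  graph is real symmetric.
\<close>

definition graph_eigenvalues :: "'a pair_pre_digraph \<Rightarrow> real set" where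
  "graph_eigenvalues G =
     {k. \<exists>vs. distinct vs \<and> set vs = pverts G \<and> eigenvalue (adj_matrix G vs) k}"

definition graph_spectral_radius :: "'a pair_pre_digraph \<Rightarrow> real" where
  "graph_spectral_radius G = Max (graph_eigenvalues G)"

text \<open>
  In a symmetric digraph the library notion of a cycle includes the closed walks
  \<open>a, b, a\<close> along a single edge.  Requiring length at least 3 leaves exactly the cycles of
  the undirected graph.
\<close>

definition undirected_cycle :: "'a pair_pre_digraph \<Rightarrow> ('a \<times> 'a) awalk \<Rightarrow> bool" where
  "undirected_cycle G c \<longleftrightarrow> pre_digraph.cycle (with_proj G) c \<and> 3 \<le> length c"

text \<open>
  The number of neighbours of a vertex is its out-degree, and the vertices on a cycle \<open>c\<close>
  are the tails of its arcs.
\<close>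

definition ggs_path :: "'a pair_pre_digraph \<Rightarrow> 'a \<Rightarrow> ('a \<times> 'a) awalk \<Rightarrow> 'a \<Rightarrow> bool" where
  "ggs_path G u P w \<longleftrightarrow>
     u \<noteq> w \<and>
     pre_digraph.apath (with_proj G) u P w \<and>
     (\<forall>v \<in> set (pre_digraph.awalk_verts (with_proj G) u P) - {u, w}.
        out_degree (with_proj G) v = 2) \<and>
     \<not> (\<exists>c. undirected_cycle G c \<and> u \<in> fst ` set c \<and> w \<in> fst ` set c)"

definition move_neighbours ::
    "'a pair_pre_digraph \<Rightarrow> 'a \<Rightarrow> 'a \<Rightarrow> 'a \<Rightarrow> 'a pair_pre_digraph" where
  "move_neighbours G u w w' =
     (let Z = {z. (w, z) \<in> parcs G \<and> z \<noteq> w'}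
      in \<lparr> pverts = pverts G,
           parcs = (parcs G - ({w} \<times> Z \<union> Z \<times> {w})) \<union> ({u} \<times> Z \<union> Z \<times> {u}) \<rparr>)"

text \<open>
  The operation depends on the choice of \<open>u\<close>, \<open>w\<close> and the path, so it is a relation between
  graphs.  The neighbour of \<open>w\<close> on the path from \<open>u\<close> to \<open>w\<close> is the tail of its last arc.
\<close>

definition is_GGS :: "'a pair_pre_digraph \<Rightarrow> 'a pair_pre_digraph \<Rightarrow> bool" where
  "is_GGS G1 G2 \<longleftrightarrow>
     (\<exists>u P w. ggs_path G1 u P w \<and> G2 = move_neighbours G1 u w (fst (last P)))"

lemma eigenvalue_adj_matrix_iff:
  assumes "distinct vs"
  shows "eigenvalue (adj_matrix G vs) k \<longleftrightarrow>
    (\<exists>x. (\<exists>v\<in>set vs. x v \<noteq> 0) \<and>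
      (\<forall>v\<in>set vs. (\<Sum>w\<in>set vs. (if (v, w) \<in> parcs G then 1 else 0) * x w) = k * x v))"
    (is "_ \<longleftrightarrow> ?R")
proof -
  define n where "n = length vs"
  have bij: "bij_betw ((!) vs) {0..<n} (set vs)"
    using assms unfolding n_def by (intro bij_betw_nth) auto
  have entry: "(adj_matrix G vs *\<^sub>v y) $ i =
      (\<Sum>w\<in>set vs. (if (vs ! i, w) \<in> parcs G then 1 else 0) * x w)"
    if y: "y \<in> carrier_vec n" and i: "i < n" and xy: "\<And>j. j < n \<Longrightarrow> y $ j = x (vs ! j)" for x y i
  proof -
    have "(adj_matrix G vs *\<^sub>v y) $ i =
        (\<Sum>j = 0..<n. (if (vs ! i, vs ! j) \<in> parcs G then 1 else 0) * x (vs ! j))"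
      using y i xy by (auto simp: adj_matrix_def scalar_prod_def n_def intro!: sum.cong)
    also have "\<dots> = (\<Sum>w\<in>set vs. (if (vs ! i, w) \<in> parcs G then 1 else 0) * x w)"
      by (rule sum.reindex_bij_betw[OF bij])
    finally show ?thesis .
  qed
  have dims: "dim_row (adj_matrix G vs) = n"
    by (simp add: adj_matrix_def n_def)
  show ?thesis
  proof
    assume "eigenvalue (adj_matrix G vs) k"
    then obtain y where y: "y \<in> carrier_vec n" "y \<noteq> 0\<^sub>v n"
      and ev: "adj_matrix G vs *\<^sub>v y = k \<cdot>\<^sub>v y"
      unfolding eigenvalue_def eigenvector_def dims by blast
    define x where "x v = y $ (the_inv_into {0..<n} ((!) vs) v)" for v
    have xy: "y $ j = x (vs ! j)" if "j < n" for j
      using that bij by (simp add: x_def the_inv_into_f_f bij_betw_def)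
    obtain i where i: "i < n" "y $ i \<noteq> 0"
      using y by (metis carrier_vecD eq_vecI index_zero_vec(1) index_zero_vec(2))
    have "\<exists>v\<in>set vs. x v \<noteq> 0"
      using i xy by (metis n_def nth_mem)
    moreover have "(\<Sum>w\<in>set vs. (if (v, w) \<in> parcs G then 1 else 0) * x w) = k * x v"
      if v: "v \<in> set vs" for v
    proof -
      obtain i where i: "i < n" "v = vs ! i"
        using v by (metis in_set_conv_nth n_def)
      have "(adj_matrix G vs *\<^sub>v y) $ i = k * y $ i"
        using ev i(1) y(1) by simp
      then show ?thesis
        using entry[OF y(1) i(1) xy] xy[OF i(1)] i(2) by simp
    qed
    ultimately show ?R by blast
  next
    assume ?R
    then obtain x where x: "\<exists>v\<in>set vs. x v \<noteq> 0"
      and ev: "\<And>v. v \<in> set vs \<Longrightarrow>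
        (\<Sum>w\<in>set vs. (if (v, w) \<in> parcs G then 1 else 0) * x w) = k * x v"
      by blast
    define y where "y = vec n (\<lambda>i. x (vs ! i))"
    have y: "y \<in> carrier_vec n" and xy: "\<And>j. j < n \<Longrightarrow> y $ j = x (vs ! j)"
      by (auto simp: y_def)
    have "y \<noteq> 0\<^sub>v n"
    proof -
      obtain i where "i < n" "x (vs ! i) \<noteq> 0"
        using x by (metis in_set_conv_nth n_def)
      then show ?thesis
        using xy by (metis index_zero_vec(1))
    qed
    moreover have "adj_matrix G vs *\<^sub>v y = k \<cdot>\<^sub>v y"
    proof (rule eq_vecI)
      show "dim_vec (adj_matrix G vs *\<^sub>v y) = dim_vec (k \<cdot>\<^sub>v y)"
        using y dims by simp
      fix i assume "i < dim_vec (k \<cdot>\<^sub>v y)"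
      then have i: "i < n" using y by simp
      then show "(adj_matrix G vs *\<^sub>v y) $ i = (k \<cdot>\<^sub>v y) $ i"
        using entry[OF y i xy] ev[of "vs ! i"] xy[OF i] y by (simp add: n_def)
    qed
    ultimately show "eigenvalue (adj_matrix G vs) k"
      using y unfolding eigenvalue_def eigenvector_def dims by blast
  qed
qed

lemma graph_eigenvalues_eq:
  assumes "distinct vs" and "set vs = pverts G"
  shows "graph_eigenvalues G = {k. eigenvalue (adj_matrix G vs) k}"
proof -
  have "eigenvalue (adj_matrix G ws) k \<longleftrightarrow> eigenvalue (adj_matrix G vs) k"
    if "distinct ws" "set ws = pverts G" for ws k
    using assms that by (simp add: eigenvalue_adj_matrix_iff)
  then show ?thesis
    using assms unfolding graph_eigenvalues_def by blast
qed

lemma finite_graph_eigenvalues: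
  assumes "finite (pverts G)"
  shows "finite (graph_eigenvalues G)"
proof -
  obtain vs where vs: "distinct vs" "set vs = pverts G"
    using assms finite_distinct_list by metis
  have A: "adj_matrix G vs \<in> carrier_mat (length vs) (length vs)"
    by (simp add: adj_matrix_def)
  have "char_poly (adj_matrix G vs) \<noteq> 0"
    using degree_monic_char_poly[OF A] by auto
  then show ?thesis
    unfolding graph_eigenvalues_eq[OF vs] eigenvalue_root_char_poly[OF A]
    by (rule poly_roots_finite)
qed

end

theory Submission
  imports Defs "HOL-Analysis.Function_Topology"
begin

text \<open>
  For a real symmetric matrix the largest eigenvalue is the maximum of the Rayleigh quotient
  \<open>x\<^sup>T A x / x\<^sup>T x\<close>.  For an adjacency matrix the numerator is \<open>\<Sum>(a, b). x a * x b\<close>, summed over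
  the arcs (\<open>adj_form\<close>).  It does not decrease when \<open>x\<close> is replaced by its absolute values, so the
  maximum is attained at a nonnegative vector \<open>x\<close>.  It therefore suffices to find, for every
  nonnegative \<open>x\<close>, a vector \<open>y\<close> of the same norm whose form on the shifted graph is at least the
  form of \<open>x\<close> on the original graph.

  The hypotheses on the path \<open>p\<close> from \<open>u\<close> to \<open>w\<close> give the graph a rigid shape
  (\<open>ggs_path_arc_decomposition\<close>): its arcs are those of \<open>p\<close>, a star joining \<open>u\<close> to a set \<open>A\<close>, a
  star joining \<open>w\<close> to a set \<open>B\<close>, and arcs that avoid \<open>p\<close>, where \<open>A\<close>, \<open>B\<close> and \<open>p\<close> are pairwise
  disjoint.  The degree condition keeps the interior of \<open>p\<close> clean, and a failure of disjointness
  would close \<open>p\<close> to a cycle through \<open>u\<close> and \<open>w\<close>.  The shift moves the star of \<open>w\<close> to \<open>u\<close>.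

  If \<open>x w \<le> x u\<close>, then \<open>y = x\<close> works, because the form changes by \<open>2 (x u - x w) \<Sum>B. x\<close>.
  Otherwise \<open>y\<close> is \<open>x\<close> with the values along \<open>p\<close> read backwards: the path contributes as before,
  the joint star at \<open>u\<close> now has the value \<open>x w\<close> in its centre, and the form changes by
  \<open>2 (x w - x u) \<Sum>A. x\<close> (\<open>adj_form_slide_stars\<close>).
\<close>

section \<open>The adjacency form and the spectral radius\<close>

definition adj_form :: "('a \<times> 'a) set \<Rightarrow> ('a \<Rightarrow> real) \<Rightarrow> real" where
  "adj_form E x = (\<Sum>(a, b)\<in>E. x a * x b)"

text \<open>
  The form is continuous on the unit sphere, which is compact in the product topology once all
  coordinates outside \<open>V\<close> are pinned to 0.  Homogeneity carries the bound from the sphere to all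
  vectors.
\<close>
lemma adj_form_attains_max:
  fixes V :: "'a set"
  assumes "finite V" and "V \<noteq> {}" and E: "E \<subseteq> V \<times> V"
  obtains x where "(\<Sum>v\<in>V. (x v)\<^sup>2) = 1"
    and "\<And>y. adj_form E y \<le> adj_form E x * (\<Sum>v\<in>V. (y v)\<^sup>2)"
proof -
  define K :: "('a \<Rightarrow> real) set" where
    "K = Pi\<^sub>E UNIV (\<lambda>v. if v \<in> V then {-1..1} else {0})"
  define S where "S = K \<inter> {x. (\<Sum>v\<in>V. (x v)\<^sup>2) = 1}"
  have "compactin (product_topology (\<lambda>v. euclidean) UNIV) K"
    unfolding K_def by (subst compactin_PiE) auto
  then have "compact K"
    by (simp add: euclidean_product_topology)
  moreover have "closed {x :: 'a \<Rightarrow> real. (\<Sum>v\<in>V. (x v)\<^sup>2) = 1}"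
    by (intro closed_Collect_eq continuous_intros continuous_on_product_coordinates)
  ultimately have "compact S"
    unfolding S_def by (rule compact_Int_closed)
  moreover obtain v0 where v0: "v0 \<in> V"
    using assms(2) by blast
  have "(\<lambda>v. if v = v0 then 1 else 0) \<in> S"
    using v0 assms(1) by (auto simp: S_def K_def if_distrib[of "\<lambda>t. t\<^sup>2"] cong: if_cong)
  then have "S \<noteq> {}" by blast
  moreover have "continuous_on S (adj_form E)"
    unfolding adj_form_def case_prod_unfold
    by (intro continuous_intros continuous_on_subset[OF continuous_on_product_coordinates]) auto
  ultimately obtain x where x: "x \<in> S" and max: "\<And>z. z \<in> S \<Longrightarrow> adj_form E z \<le> adj_form E x"
    using continuous_attains_sup by metis
  have "adj_form E y \<le> adj_form E x * (\<Sum>v\<in>V. (y v)\<^sup>2)" for y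
  proof (cases "(\<Sum>v\<in>V. (y v)\<^sup>2) = 0")
    case True
    then have "y v = 0" if "v \<in> V" for v
      using that assms(1) by (simp add: sum_nonneg_eq_0_iff)
    then have "adj_form E y = 0"
      using E unfolding adj_form_def by (intro sum.neutral) auto
    with True show ?thesis by simp
  next
    case False
    define N where "N = (\<Sum>v\<in>V. (y v)\<^sup>2)"
    have N: "N > 0"
      using False unfolding N_def by (metis less_eq_real_def sum_nonneg zero_le_power2)
    define z where "z v = (if v \<in> V then y v / sqrt N else 0)" for v
    have z1: "(\<Sum>v\<in>V. (z v)\<^sup>2) = 1"
      using N by (simp add: z_def power_divide flip: sum_divide_distrib N_def)
    have "z v \<in> {-1..1}" if "v \<in> V" for v
    proof -
      have "(z v)\<^sup>2 \<le> 1"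
        using member_le_sum[of v V "\<lambda>v. (z v)\<^sup>2"] that assms(1) z1 by simp
      then show ?thesis
        by (simp add: abs_square_le_1 abs_le_iff)
    qed
    moreover have "z v = 0" if "v \<notin> V" for v
      using that by (simp add: z_def)
    ultimately have "z \<in> S"
      using z1 by (auto simp: S_def K_def)
    moreover have "adj_form E z = adj_form E y / N"
    proof -
      have "adj_form E z = (\<Sum>(a, b)\<in>E. (y a * y b) / N)"
        unfolding adj_form_def using E N by (intro sum.cong) (auto simp: z_def)
      then show ?thesis
        by (simp add: adj_form_def sum_divide_distrib case_prod_unfold)
    qed
    ultimately have "adj_form E y / N \<le> adj_form E x"
      using max by metis
    then show ?thesis
      using N by (simp add: pos_divide_le_eq flip: N_def)
  qed
  with x show thesis
    by (intro that) (auto simp: S_def)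
qed

lemma adj_form_eq_sum:
  assumes "finite V" and "E \<subseteq> V \<times> V"
  shows "adj_form E x = (\<Sum>v\<in>V. x v * (\<Sum>w\<in>V. (if (v, w) \<in> E then 1 else 0) * x w))"
proof -
  have "adj_form E x = (\<Sum>p\<in>V \<times> V. if p \<in> E then x (fst p) * x (snd p) else 0)"
    unfolding adj_form_def case_prod_unfold
    using assms by (simp add: sum.If_cases Int_absorb1)
  also have "\<dots> = (\<Sum>v\<in>V. \<Sum>w\<in>V. x v * ((if (v, w) \<in> E then 1 else 0) * x w))"
    by (simp add: sum.cartesian_product case_prod_unfold if_distrib cong: if_cong)
       (auto intro!: sum.cong)
  finally show ?thesis
    by (simp add: sum_distrib_left)
qed

text \<open>
  First-order condition at the maximum: moving \<open>x\<close> by \<open>t\<close> in the coordinate \<open>v\<close> changes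
  \<open>adj_form E x - \<mu> * \<Sum>x\<^sup>2\<close> by a quadratic polynomial in \<open>t\<close> without constant term.  It is never
  positive, so its linear coefficient, twice the \<open>v\<close> entry of \<open>A x - \<mu> x\<close>, vanishes.
\<close>
lemma adj_form_maximizer_eigenvector:
  assumes fin: "finite V" and E: "E \<subseteq> V \<times> V" and sym: "sym E"
    and le: "\<And>y. adj_form E y \<le> \<mu> * (\<Sum>v\<in>V. (y v)\<^sup>2)"
    and eq: "adj_form E x = \<mu> * (\<Sum>v\<in>V. (x v)\<^sup>2)"
    and v: "v \<in> V"
  shows "(\<Sum>w\<in>V. (if (v, w) \<in> E then 1 else 0) * x w) = \<mu> * x v"
proof -
  define d :: "'a \<Rightarrow> real" where "d w = (if w = v then 1 else 0)" for w
  define s where "s = (\<Sum>w\<in>V. (if (v, w) \<in> E then 1 else 0) * x w)"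
  define c where "c = s - \<mu> * x v"
  define k where "k = adj_form E d - \<mu>"
  have left: "(\<Sum>(a, b)\<in>E. d a * x b) = s"
  proof -
    have "(\<Sum>(a, b)\<in>E. d a * x b) = (\<Sum>p\<in>V \<times> V. if p \<in> E then d (fst p) * x (snd p) else 0)"
      unfolding case_prod_unfold using E fin by (simp add: sum.If_cases Int_absorb1)
    also have "\<dots> = (\<Sum>a\<in>V. \<Sum>b\<in>V. if (a, b) \<in> E then d a * x b else 0)"
      by (simp add: sum.cartesian_product case_prod_unfold)
    also have "\<dots> = (\<Sum>a\<in>V. if a = v then s else 0)"
      by (intro sum.cong) (auto simp: d_def s_def intro!: sum.cong sum.neutral)
    finally show ?thesis using fin v by simp
  qed
  have right: "(\<Sum>(a, b)\<in>E. x a * d b) = s"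
  proof -
    have "(\<Sum>(a, b)\<in>E. x a * d b) = (\<Sum>(a, b)\<in>E. d a * x b)"
      by (rule sum.reindex_bij_witness[of _ prod.swap prod.swap])
         (use sym in \<open>auto simp: symD\<close>)
    with left show ?thesis by simp
  qed
  have "2 * t * c + t\<^sup>2 * k \<le> 0" for t
  proof -
    define y where "y w = x w + t * d w" for w
    have "adj_form E y = (\<Sum>(a, b)\<in>E. x a * x b + t * (d a * x b) + t * (x a * d b) + t\<^sup>2 * (d a * d b))"
      unfolding adj_form_def y_def
      by (intro sum.cong) (auto simp: algebra_simps power2_eq_square)
    also have "\<dots> = adj_form E x + t * (\<Sum>(a, b)\<in>E. d a * x b) +
        t * (\<Sum>(a, b)\<in>E. x a * d b) + t\<^sup>2 * adj_form E d"
      by (simp add: adj_form_def case_prod_unfold sum.distrib sum_distrib_left)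
    finally have 1: "adj_form E y = adj_form E x + 2 * t * s + t\<^sup>2 * adj_form E d"
      by (simp add: left right)
    have "(\<Sum>w\<in>V. (y w)\<^sup>2) = (\<Sum>w\<in>V. (x w)\<^sup>2 + (if w = v then 2 * t * x v + t\<^sup>2 else 0))"
      by (intro sum.cong) (auto simp: y_def d_def algebra_simps power2_eq_square)
    also have "\<dots> = (\<Sum>w\<in>V. (x w)\<^sup>2) + 2 * t * x v + t\<^sup>2"
      using fin v by (simp add: sum.distrib)
    finally show ?thesis
      using le[of y] eq 1 by (simp add: c_def k_def algebra_simps)
  qed
  note quad = this
  \<comment> \<open>At \<open>t = c / m\<close> with \<open>m > \<bar>k\<bar>\<close> the linear term dominates, so the value is positive unless \<open>c = 0\<close>.\<close>
  define m where "m = \<bar>k\<bar> + 1"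
  have m: "m > 0" "2 * m + k > 0"
    by (auto simp: m_def)
  have "2 * (c / m) * c + (c / m)\<^sup>2 * k = c\<^sup>2 * (2 * m + k) / m\<^sup>2"
    using m(1) by (simp add: field_simps power2_eq_square)
  then have "c\<^sup>2 * (2 * m + k) / m\<^sup>2 \<le> 0"
    using quad[of "c / m"] by simp
  then have "c = 0"
    using m by (simp add: divide_le_0_iff mult_le_0_iff)
  then show ?thesis by (simp add: c_def s_def)
qed

lemma graph_eigenvalue_iff:
  assumes "finite (pverts G)"
  shows "k \<in> graph_eigenvalues G \<longleftrightarrow>
    (\<exists>x. (\<exists>v\<in>pverts G. x v \<noteq> 0) \<and>
      (\<forall>v\<in>pverts G. (\<Sum>w\<in>pverts G. (if (v, w) \<in> parcs G then 1 else 0) * x w) = k * x v))"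
proof -
  obtain vs where vs: "distinct vs" "set vs = pverts G"
    using assms finite_distinct_list by metis
  show ?thesis
    using eigenvalue_adj_matrix_iff[OF vs(1), of G k] vs graph_eigenvalues_eq[OF vs] by auto
qed

lemma (in pair_graph) parcs_subset: "parcs G \<subseteq> pverts G \<times> pverts G"
  using wellformed' by auto

lemma (in pair_graph) sym_parcs: "sym (parcs G)"
  using arcs_symmetric by (auto intro: symI)

text \<open>
  The maximum of the Rayleigh quotient is itself an eigenvalue.  This gives at once that the set of
  real eigenvalues is nonempty, so that its \<open>Max\<close> is meaningful, and that this \<open>Max\<close> bounds every
  Rayleigh quotient.
\<close>
lemma (in pair_graph) spectral_radius_bounds_adj_form:
  assumes "pverts G \<noteq> {}"
  shows "graph_spectral_radius G \<in> graph_eigenvalues G"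
    and "adj_form (parcs G) y \<le> graph_spectral_radius G * (\<Sum>v\<in>pverts G. (y v)\<^sup>2)"
proof -
  note fin = pair_finite_verts
  obtain x where x: "(\<Sum>v\<in>pverts G. (x v)\<^sup>2) = 1"
    and max: "\<And>y. adj_form (parcs G) y \<le> adj_form (parcs G) x * (\<Sum>v\<in>pverts G. (y v)\<^sup>2)"
    using adj_form_attains_max[OF fin assms parcs_subset] by blast
  define \<mu> where "\<mu> = adj_form (parcs G) x"
  have "\<exists>v\<in>pverts G. x v \<noteq> 0"
    using x by (metis power_zero_numeral sum.neutral zero_neq_one)
  moreover have "(\<Sum>w\<in>pverts G. (if (v, w) \<in> parcs G then 1 else 0) * x w) = \<mu> * x v"
    if "v \<in> pverts G" for v
    by (rule adj_form_maximizer_eigenvector[OF fin parcs_subset sym_parcs])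
       (use that max x in \<open>auto simp: \<mu>_def\<close>)
  ultimately have \<mu>: "\<mu> \<in> graph_eigenvalues G"
    by (auto simp: graph_eigenvalue_iff[OF fin])
  show "graph_spectral_radius G \<in> graph_eigenvalues G"
    unfolding graph_spectral_radius_def
    using \<mu> finite_graph_eigenvalues[OF fin] by (intro Max_in) auto
  have "\<mu> \<le> graph_spectral_radius G"
    unfolding graph_spectral_radius_def
    using \<mu> finite_graph_eigenvalues[OF fin] by (intro Max_ge)
  then show "adj_form (parcs G) y \<le> graph_spectral_radius G * (\<Sum>v\<in>pverts G. (y v)\<^sup>2)"
    using max[of y] mult_right_mono[of \<mu> "graph_spectral_radius G" "\<Sum>v\<in>pverts G. (y v)\<^sup>2"]
    by (simp add: \<mu>_def sum_nonneg)
qed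

text \<open>
  The vector is the entrywise absolute value of an eigenvector.  Taking
  absolute values keeps the norm and cannot decrease the form, whose coefficients are nonnegative.
\<close>
lemma (in pair_graph) spectral_radius_le_adj_form:
  assumes "pverts G \<noteq> {}"
  obtains x where "\<And>v. 0 \<le> x v" and "0 < (\<Sum>v\<in>pverts G. (x v)\<^sup>2)"
    and "graph_spectral_radius G * (\<Sum>v\<in>pverts G. (x v)\<^sup>2) \<le> adj_form (parcs G) x"
proof -
  note fin = pair_finite_verts
  obtain x where x: "\<exists>v\<in>pverts G. x v \<noteq> 0"
    and ev: "\<And>v. v \<in> pverts G \<Longrightarrow> (\<Sum>w\<in>pverts G. (if (v, w) \<in> parcs G then 1 else 0) * x w) =
      graph_spectral_radius G * x v"
    using spectral_radius_bounds_adj_form(1)[OF assms] unfolding graph_eigenvalue_iff[OF fin]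
    by blast
  have "graph_spectral_radius G * (\<Sum>v\<in>pverts G. (x v)\<^sup>2) =
      (\<Sum>v\<in>pverts G. x v * (graph_spectral_radius G * x v))"
    by (simp add: sum_distrib_left power2_eq_square mult_ac)
  also have "\<dots> = adj_form (parcs G) x"
    unfolding adj_form_eq_sum[OF fin parcs_subset] by (intro sum.cong) (simp_all add: ev)
  also have "\<dots> \<le> adj_form (parcs G) (\<lambda>v. \<bar>x v\<bar>)"
    unfolding adj_form_def by (intro sum_mono) (auto simp flip: abs_mult)
  finally show thesis
    using x fin by (intro that[of "\<lambda>v. \<bar>x v\<bar>"]) (auto intro!: sum_pos2)
qed

section \<open>Sliding a star along a path\<close>

definition star :: "'a \<Rightarrow> 'a set \<Rightarrow> ('a \<times> 'a) set" where
  "star s Z = {s} \<times> Z \<union> Z \<times> {s}"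

definition path_arcs :: "'a list \<Rightarrow> ('a \<times> 'a) set" where
  "path_arcs p = {(p ! i, p ! j) | i j.
     i < length p \<and> j < length p \<and> (j = Suc i \<or> i = Suc j)}"

lemma adj_form_Un_disjoint:
  assumes "finite A" and "finite B" and "A \<inter> B = {}"
  shows "adj_form (A \<union> B) x = adj_form A x + adj_form B x"
  unfolding adj_form_def using assms by (rule sum.union_disjoint)

lemma adj_form_cong:
  assumes "\<And>a b. (a, b) \<in> E \<Longrightarrow> x a = y a \<and> x b = y b"
  shows "adj_form E x = adj_form E y"
  unfolding adj_form_def using assms by (intro sum.cong) auto

lemma adj_form_star:
  assumes "finite Z" and "s \<notin> Z"
  shows "adj_form (star s Z) x = 2 * x s * sum x Z"
proof -
  have "adj_form ({s} \<times> Z) x = x s * sum x Z" "adj_form (Z \<times> {s}) x = x s * sum x Z"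
    by (simp_all add: adj_form_def sum_distrib_left mult_ac flip: sum.cartesian_product)
  moreover have "({s} \<times> Z) \<inter> (Z \<times> {s}) = {}"
    using assms by auto
  ultimately show ?thesis
    unfolding star_def using assms by (simp add: adj_form_Un_disjoint)
qed

lemma path_arcs_subset: "path_arcs p \<subseteq> set p \<times> set p"
  by (auto simp: path_arcs_def)

text \<open>
  The reversal of \<open>p\<close> as an involution of all vertices, so that it can be used as a substitution
  in sums over vertices and over arcs.
\<close>
lemma obtain_list_reversal:
  assumes "distinct p"
  obtains r where "\<And>v. r (r v) = v" and "\<And>v. v \<notin> set p \<Longrightarrow> r v = v"
    and "\<And>i. i < length p \<Longrightarrow> r (p ! i) = p ! (length p - 1 - i)"
proof -
  define idx where "idx v = (THE i. i < length p \<and> p ! i = v)" for v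
  have idx: "idx (p ! i) = i" if "i < length p" for i
    unfolding idx_def using that assms by (intro the_equality) (auto simp: nth_eq_iff_index_eq)
  define r where "r v = (if v \<in> set p then p ! (length p - 1 - idx v) else v)" for v
  have r: "r (p ! i) = p ! (length p - 1 - i)" if "i < length p" for i
    using that by (simp add: r_def idx)
  have "r (r v) = v" for v
  proof (cases "v \<in> set p")
    case True
    then obtain i where "i < length p" "v = p ! i" by (metis in_set_conv_nth)
    then show ?thesis by (simp add: r)
  qed (simp add: r_def)
  moreover have "r v = v" if "v \<notin> set p" for v
    using that by (simp add: r_def)
  ultimately show thesis
    using r by (rule that)
qed

lemma adj_form_path_arcs_reversal:
  assumes inv: "\<And>v. r (r v) = v"
    and r: "\<And>i. i < length p \<Longrightarrow> r (p ! i) = p ! (length p - 1 - i)"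
  shows "adj_form (path_arcs p) (\<lambda>v. x (r v)) = adj_form (path_arcs p) x"
proof -
  have "map_prod r r e \<in> path_arcs p" if "e \<in> path_arcs p" for e
  proof -
    obtain i j where ij: "e = (p ! i, p ! j)" "i < length p" "j < length p" "j = Suc i \<or> i = Suc j"
      using \<open>e \<in> path_arcs p\<close> by (auto simp: path_arcs_def)
    define i' j' where "i' = length p - 1 - i" and "j' = length p - 1 - j"
    have "map_prod r r e = (p ! i', p ! j')"
      using ij r by (simp add: i'_def j'_def)
    moreover have "i' < length p" "j' < length p" "j' = Suc i' \<or> i' = Suc j'"
      using ij unfolding i'_def j'_def by linarith+
    ultimately show ?thesis
      unfolding path_arcs_def by blast
  qed
  then show ?thesis
    unfolding adj_form_def
    by (intro sum.reindex_bij_witness[of _ "map_prod r r" "map_prod r r"])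
       (simp_all add: inv case_prod_unfold prod_eq_iff)
qed

text \<open>
  The core comparison.  The two graphs that collect both stars at \<open>u\<close> or both at \<open>w\<close> are isomorphic
  by reversing \<open>p\<close>, and the end with the larger value of \<open>x\<close> is the better centre.  Instead of
  transporting the graph, the second case transports the vector.
\<close>
lemma adj_form_slide_stars:
  assumes p: "distinct p" "p \<noteq> []" and ends: "u = p ! 0" "w = p ! (length p - 1)" "u \<noteq> w"
    and fin: "finite A" "finite B" "finite R"
    and disj: "A \<inter> B = {}" "A \<inter> set p = {}" "B \<inter> set p = {}"
    and R: "R \<subseteq> (- set p) \<times> (- set p)"
    and V: "finite V" "set p \<subseteq> V"
    and nonneg: "\<And>v. 0 \<le> x v"
  obtains y where "(\<Sum>v\<in>V. (y v)\<^sup>2) = (\<Sum>v\<in>V. (x v)\<^sup>2)"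
    and "adj_form (path_arcs p \<union> star u A \<union> star w B \<union> R) x
      \<le> adj_form (path_arcs p \<union> star u (A \<union> B) \<union> R) y"
proof -
  have uw: "u \<in> set p" "w \<in> set p"
    using p ends by auto
  have finT: "finite (path_arcs p)"
    by (rule finite_subset[OF path_arcs_subset]) simp
  have finstar: "finite (star s Z)" if "finite Z" for s :: 'a and Z
    using that by (simp add: star_def)
  have T: "a \<in> set p \<and> b \<in> set p" if "(a, b) \<in> path_arcs p" for a b
    using that path_arcs_subset by blast
  have off: "v \<notin> set p" if "v \<in> A \<or> v \<in> B" for v
    using that disj by blast
  have not_R: "e \<notin> R" if "e \<in> path_arcs p \<or> e \<in> star u Z \<or> e \<in> star w Z" for e Z
  proof -
    have "fst e \<in> set p \<or> snd e \<in> set p"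
      using that T[of "fst e" "snd e"] uw by (auto simp: star_def)
    then show ?thesis using R by auto
  qed
  have E1: "adj_form (path_arcs p \<union> star u A \<union> star w B \<union> R) x =
      adj_form (path_arcs p) x + 2 * x u * sum x A + 2 * x w * sum x B + adj_form R x"
  proof -
    have "(path_arcs p \<union> star u A \<union> star w B) \<inter> R = {}"
      by (intro Int_emptyI) (use not_R in blast)
    moreover have "e \<notin> star w B" if "e \<in> path_arcs p \<or> e \<in> star u A" for e
      using that T[of "fst e" "snd e"] off uw disj(1) ends(3) by (auto simp: star_def)
    then have "(path_arcs p \<union> star u A) \<inter> star w B = {}"
      by (simp add: disjoint_iff)
    moreover have "path_arcs p \<inter> star u A = {}"
      using T off by (auto simp: star_def)
    moreover have "u \<notin> A" "w \<notin> B"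
      using uw disj by auto
    ultimately show ?thesis
      using fin finT by (simp add: adj_form_Un_disjoint adj_form_star finstar)
  qed
  have E2: "adj_form (path_arcs p \<union> star u (A \<union> B) \<union> R) y =
      adj_form (path_arcs p) y + 2 * y u * (sum y A + sum y B) + adj_form R y" for y
  proof -
    have "(path_arcs p \<union> star u (A \<union> B)) \<inter> R = {}"
      by (intro Int_emptyI) (use not_R in blast)
    moreover have "path_arcs p \<inter> star u (A \<union> B) = {}"
      using T off by (auto simp: star_def)
    moreover have "u \<notin> A \<union> B"
      using uw disj by auto
    ultimately show ?thesis
      using fin finT disj by (simp add: adj_form_Un_disjoint adj_form_star finstar sum.union_disjoint)
  qed
  show thesis
  proof (cases "x w \<le> x u")
    case True
    then have "x w * sum x B \<le> x u * sum x B"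
      using nonneg by (intro mult_right_mono sum_nonneg) auto
    then show thesis
      by (intro that[of x]) (simp_all add: E1 E2 algebra_simps)
  next
    case False
    obtain r where r: "\<And>v. r (r v) = v" "\<And>v. v \<notin> set p \<Longrightarrow> r v = v"
        "\<And>i. i < length p \<Longrightarrow> r (p ! i) = p ! (length p - 1 - i)"
      using obtain_list_reversal[OF p(1)] by blast
    define y where "y v = x (r v)" for v
    have in_V: "r v \<in> V" if "v \<in> V" for v
      using that r(1,2) V(2) by (metis subsetD)
    have "(\<Sum>v\<in>V. (y v)\<^sup>2) = (\<Sum>v\<in>V. (x v)\<^sup>2)"
      unfolding y_def
      by (rule sum.reindex_bij_witness[of _ r r]) (use r(1) in_V in simp_all)
    moreover have "adj_form (path_arcs p) y = adj_form (path_arcs p) x"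
      unfolding y_def using r(1,3) by (rule adj_form_path_arcs_reversal)
    moreover have "adj_form R y = adj_form R x"
      using R r(2) by (intro adj_form_cong) (auto simp: y_def)
    moreover have "y u = x w"
      using r(3)[of 0] p ends by (simp add: y_def)
    moreover have "sum y A = sum x A" "sum y B = sum x B"
      unfolding y_def using r(2) off by (auto intro!: sum.cong)
    moreover have "x u * sum x A \<le> x w * sum x A"
      using False nonneg by (intro mult_right_mono sum_nonneg) auto
    ultimately show thesis
      by (intro that[of y]) (simp_all add: E1 E2 algebra_simps)
  qed
qed

section \<open>The shape of a graph around a shift path\<close>

lemma pcas_pawalk_verts_ends:
  assumes "pcas u P w"
  shows "pawalk_verts u P ! 0 = u" and "pawalk_verts u P ! length P = w"
proof -
  show "pawalk_verts u P ! 0 = u"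
    using assms by (cases P) auto
  show "pawalk_verts u P ! length P = w"
    using assms by (induct P arbitrary: u) auto
qed

lemma pcas_nth:
  assumes "pcas u P w" and "i < length P"
  shows "P ! i = (pawalk_verts u P ! i, pawalk_verts u P ! Suc i)"
  using assms
proof (induct P arbitrary: u i)
  case (Cons e P)
  then show ?case
    by (cases i) (auto simp: pcas_pawalk_verts_ends(1))
qed simp

lemma length_pawalk_verts: "length (pawalk_verts u P) = Suc (length P)"
  by (induct P arbitrary: u) auto

text \<open>
  This produces the forbidden cycles: \<open>Q\<close> is the way back from \<open>w\<close> to \<open>u\<close>, over one chord or over a
  common neighbour.
\<close>
lemma (in pair_graph) undirected_cycle_of_closed_apath:
  assumes P: "apath u P w" and "P \<noteq> []" and Q: "awalk w Q u" and "Q \<noteq> []"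
    and len: "3 \<le> length P + length Q"
    and fresh: "distinct (tl (pawalk_verts u P) @ tl (pawalk_verts w Q))"
  shows "\<exists>c. undirected_cycle G c \<and> u \<in> fst ` set c \<and> w \<in> fst ` set c"
proof -
  have PQ: "awalk u (P @ Q) u"
    using P Q by (auto simp: apath_def intro: awalk_appendI)
  have last: "last (pawalk_verts u P) = w"
    using P by (auto simp: apath_def)
  have "pawalk_verts u (P @ Q) = pawalk_verts u P @ tl (pawalk_verts w Q)"
    using awalk_verts_append[OF PQ] last by simp
  then have "tl (pawalk_verts u (P @ Q)) = tl (pawalk_verts u P) @ tl (pawalk_verts w Q)"
    by (simp add: tl_append2 awalk_verts_non_Nil)
  then have "undirected_cycle G (P @ Q)"
    using PQ len fresh \<open>P \<noteq> []\<close> unfolding undirected_cycle_def cycle_def by auto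
  moreover have "u \<in> fst ` set (P @ Q)" "w \<in> fst ` set (P @ Q)"
  proof -
    have "fst (hd P) = u" "fst (hd Q) = w"
      using P Q \<open>P \<noteq> []\<close> \<open>Q \<noteq> []\<close> by (cases P; cases Q; auto simp: apath_def awalk_Cons_iff)+
    then show "u \<in> fst ` set (P @ Q)" "w \<in> fst ` set (P @ Q)"
      using \<open>P \<noteq> []\<close> \<open>Q \<noteq> []\<close> by (auto simp: image_iff intro!: bexI hd_in_set)
  qed
  ultimately show ?thesis by blast
qed

text \<open>
  An interior vertex of the path has its two path neighbours and no others, so an arc that leaves
  the path does so at \<open>u\<close> or \<open>w\<close>.  Another neighbour of \<open>u\<close> or \<open>w\<close> on the path would have to be the
  opposite end, and a common neighbour off the path would join the ends as well; both close the path
  to a cycle.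
\<close>
lemma (in pair_graph) ggs_path_arc_decomposition:
  assumes ggs: "ggs_path G u P w"
  defines "B \<equiv> {z. (w, z) \<in> parcs G \<and> z \<noteq> fst (last P)}"
  obtains p A R where "distinct p" and "p \<noteq> []" and "u = p ! 0" and "w = p ! (length p - 1)"
    and "set p \<subseteq> pverts G"
    and "parcs G = path_arcs p \<union> star u A \<union> star w B \<union> R"
    and "A \<inter> B = {}" and "A \<inter> set p = {}" and "B \<inter> set p = {}"
    and "R \<subseteq> (- set p) \<times> (- set p)"
proof -
  define p where "p = pawalk_verts u P"
  define l where "l = length P"
  have uw: "u \<noteq> w" and path: "apath u P w"
    and deg: "\<And>v. v \<in> set p - {u, w} \<Longrightarrow> out_degree (with_proj G) v = 2"
    and acyc: "\<not> (\<exists>c. undirected_cycle G c \<and> u \<in> fst ` set c \<and> w \<in> fst ` set c)"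
    using ggs unfolding ggs_path_def p_def awalk_verts_with_proj_eq by blast+
  have walk: "awalk u P w" and dist: "distinct p"
    using path by (auto simp: apath_def p_def)
  then have cas: "pcas u P w" and PE: "set P \<subseteq> parcs G" and pV: "set p \<subseteq> pverts G"
    by (auto simp: p_def)
  have len: "length p = Suc l"
    by (simp add: p_def l_def length_pawalk_verts)
  have p0: "p ! 0 = u" and pl: "p ! l = w"
    using pcas_pawalk_verts_ends[OF cas] by (auto simp: p_def l_def)
  have "l > 0"
    using uw p0 pl by (cases l) auto
  then have "P \<noteq> []" by (auto simp: l_def)
  have nth_eq: "p ! i = p ! j \<longleftrightarrow> i = j" if "i \<le> l" "j \<le> l" for i j
    using that dist len by (simp add: nth_eq_iff_index_eq)
  have step: "(p ! i, p ! Suc i) \<in> parcs G" if "i < l" for i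
    using pcas_nth[OF cas, of i] PE that nth_mem[of i P] by (auto simp: p_def l_def)
  have "last P = (p ! (l - 1), p ! l)"
    using pcas_nth[OF cas, of "l - 1"] \<open>l > 0\<close> \<open>P \<noteq> []\<close>
    by (simp add: last_conv_nth p_def l_def)
  then have B: "B = {z. (w, z) \<in> parcs G \<and> z \<noteq> p ! (l - 1)}"
    by (simp add: B_def)
  define A where "A = {z. (u, z) \<in> parcs G \<and> z \<noteq> p ! 1}"
  define R where "R = {(a, b) \<in> parcs G. a \<notin> set p \<and> b \<notin> set p}"

  have interior: "b = p ! (i - 1) \<or> b = p ! Suc i"
    if i: "0 < i" "i < l" and b: "(p ! i, b) \<in> parcs G" for i b
  proof -
    define N where "N = out_arcs (with_proj G) (p ! i)"
    have "p ! i \<in> set p - {u, w}"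
      using i nth_eq[of i 0] nth_eq[of i l] p0 pl len by auto
    then have "card N = 2"
      using deg by (simp add: N_def out_degree_def)
    moreover have "{(p ! i, p ! (i - 1)), (p ! i, p ! Suc i)} \<subseteq> N"
      using i step[of i] arcs_symmetric[OF step[of "i - 1"]] by (auto simp: N_def)
    moreover have "p ! (i - 1) \<noteq> p ! Suc i"
      using i nth_eq[of "i - 1" "Suc i"] by auto
    ultimately have "N = {(p ! i, p ! (i - 1)), (p ! i, p ! Suc i)}"
      by (intro card_subset_eq[symmetric]) (auto simp: N_def intro: card_ge_0_finite)
    moreover have "(p ! i, b) \<in> N"
      using b by (simp add: N_def)
    ultimately show ?thesis by auto
  qed

  have tl_p: "distinct (tl p)" "w \<noteq> u" "u \<notin> set (tl p)"
    using dist p0 uw len by (cases p; auto)+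
  \<comment> \<open>For \<open>l = 1\<close> the arc from \<open>w\<close> to \<open>u\<close> is the path itself and gives only a closed walk of length 2.\<close>
  have chord: False if "(w, u) \<in> parcs G" "l \<ge> 2"
  proof -
    have walk_back: "awalk w [(w, u)] u"
      using that(1) arc_implies_awalk[of "(w, u)"] by simp
    have fresh: "distinct (tl (pawalk_verts u P) @ tl (pawalk_verts w [(w, u)]))"
      using tl_p by (simp add: p_def)
    have "3 \<le> length P + length [(w, u)]"
      using that(2) by (simp add: l_def)
    then show False
      using acyc undirected_cycle_of_closed_apath[OF path \<open>P \<noteq> []\<close> walk_back _ _ fresh] by blast
  qed
  have common: False if z: "(w, z) \<in> parcs G" "(z, u) \<in> parcs G" "z \<notin> set p" for z
  proof -
    have walk_back: "awalk w [(w, z), (z, u)] u"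
      using z wellformed' by (auto simp: awalk_Cons_iff awalk_Nil_iff)
    have "z \<notin> set (tl p)" "z \<noteq> u"
      using z(3) p0 len by (cases p; auto)+
    then have fresh: "distinct (tl (pawalk_verts u P) @ tl (pawalk_verts w [(w, z), (z, u)]))"
      using tl_p by (simp add: p_def)
    have "3 \<le> length P + length [(w, z), (z, u)]"
      using \<open>l > 0\<close> by (simp add: l_def Suc_le_eq)
    then show False
      using acyc undirected_cycle_of_closed_apath[OF path \<open>P \<noteq> []\<close> walk_back _ _ fresh] by blast
  qed

  have on_path: "\<exists>i\<le>l. v = p ! i" if "v \<in> set p" for v
    using that len by (metis in_set_conv_nth less_Suc_eq_le)
  have A_off: "v \<notin> A" if "v \<in> set p" for v
  proof
    assume "v \<in> A"
    then have v: "(u, v) \<in> parcs G" "(v, u) \<in> parcs G" "v \<noteq> p ! 1"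
      using arcs_symmetric by (auto simp: A_def)
    obtain i where i: "i \<le> l" "v = p ! i" using on_path[OF \<open>v \<in> set p\<close>] by blast
    consider "i = 0" | "0 < i" "i < l" | "i = l" "l \<ge> 2" | "i = l" "l = 1"
      using i(1) \<open>l > 0\<close> by linarith
    then show False
    proof cases
      case 1
      then show False using no_loops'[OF v(1)] i p0 by simp
    next
      case 2
      then have "p ! 0 = p ! (i - 1) \<or> p ! 0 = p ! Suc i"
        using interior[of i u] v(2) i(2) p0 by simp
      moreover have "0 \<le> l" "i - 1 \<le> l" "Suc i \<le> l"
        using 2 by linarith+
      ultimately have "0 = i - 1 \<or> 0 = Suc i"
        using nth_eq by blast
      then have "i = 1"
        using 2 by linarith
      then show False using v(3) i(2) by simp
    next
      case 3
      then show False using chord v(2) i(2) pl by simp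
    next
      case 4
      then show False using v(3) i(2) by simp
    qed
  qed
  have B_off: "v \<notin> B" if "v \<in> set p" for v
  proof
    assume "v \<in> B"
    then have v: "(w, v) \<in> parcs G" "(v, w) \<in> parcs G" "v \<noteq> p ! (l - 1)"
      using arcs_symmetric by (auto simp: B)
    obtain i where i: "i \<le> l" "v = p ! i" using on_path[OF \<open>v \<in> set p\<close>] by blast
    consider "i = l" | "0 < i" "i < l" | "i = 0" "l \<ge> 2" | "i = 0" "l = 1"
      using i(1) \<open>l > 0\<close> by linarith
    then show False
    proof cases
      case 1
      then show False using no_loops'[OF v(1)] i pl by simp
    next
      case 2
      then have "p ! l = p ! (i - 1) \<or> p ! l = p ! Suc i"
        using interior[of i w] v(2) i(2) pl by simp
      moreover have "l \<le> l" "i - 1 \<le> l" "Suc i \<le> l"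
        using 2 by linarith+
      ultimately have "l = i - 1 \<or> l = Suc i"
        using nth_eq by blast
      then have "i = l - 1"
        using 2 by linarith
      then show False using v(3) i(2) by simp
    next
      case 3
      then show False using chord v(1) i(2) p0 by simp
    next
      case 4
      then show False using v(3) i(2) by simp
    qed
  qed
  have AB: "A \<inter> B = {}"
    using common A_off arcs_symmetric by (auto simp: A_def B)

  have from_path: "(a, b) \<in> path_arcs p \<union> star u A \<union> star w B"
    if "(a, b) \<in> parcs G" "a \<in> set p" for a b
  proof -
    obtain i where i: "i \<le> l" "a = p ! i" using on_path[OF \<open>a \<in> set p\<close>] by blast
    have fwd: "(p ! j, p ! Suc j) \<in> path_arcs p" "(p ! Suc j, p ! j) \<in> path_arcs p" if "j < l" for j
    proof -
      have "j < length p" "Suc j < length p"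
        using that len by auto
      then show "(p ! j, p ! Suc j) \<in> path_arcs p" "(p ! Suc j, p ! j) \<in> path_arcs p"
        unfolding path_arcs_def by blast+
    qed
    consider "i = 0" | "0 < i" "i < l" | "i = l"
      using i(1) by linarith
    then show ?thesis
    proof cases
      case 1
      then show ?thesis
        using that(1) i(2) p0 fwd(1)[of 0] \<open>l > 0\<close> by (cases "b = p ! 1") (auto simp: star_def A_def)
    next
      case 2
      then have "b = p ! (i - 1) \<or> b = p ! Suc i"
        using interior that(1) i(2) by simp
      moreover have "(p ! i, p ! (i - 1)) \<in> path_arcs p"
      proof -
        have "i - 1 < l" "Suc (i - 1) = i"
          using 2 by linarith+
        then show ?thesis using fwd(2) by metis
      qed
      ultimately show ?thesis
        using fwd(1)[of i] 2 i(2) by blast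
    next
      case 3
      have "(p ! l, p ! (l - 1)) \<in> path_arcs p"
        using fwd(2)[of "l - 1"] \<open>l > 0\<close> by simp
      then show ?thesis
        using that(1) i(2) pl 3 by (cases "b = p ! (l - 1)") (auto simp: star_def B)
    qed
  qed
  have sym: "(b, a) \<in> path_arcs p \<union> star u A \<union> star w B"
    if "(a, b) \<in> path_arcs p \<union> star u A \<union> star w B" for a b
    using that by (auto simp: path_arcs_def star_def)
  have "parcs G = path_arcs p \<union> star u A \<union> star w B \<union> R"
  proof
    show "parcs G \<subseteq> path_arcs p \<union> star u A \<union> star w B \<union> R"
    proof
      fix e assume e: "e \<in> parcs G"
      obtain a b where ab: "e = (a, b)" by (cases e)
      have "(b, a) \<in> parcs G" using arcs_symmetric e ab by blast
      then show "e \<in> path_arcs p \<union> star u A \<union> star w B \<union> R"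
        using from_path[of a b] from_path[of b a] sym[of b a] e ab by (auto simp: R_def)
    qed
    have "path_arcs p \<subseteq> parcs G"
      using step arcs_symmetric len by (auto simp: path_arcs_def)
    then show "path_arcs p \<union> star u A \<union> star w B \<union> R \<subseteq> parcs G"
      using arcs_symmetric by (auto simp: star_def A_def B R_def)
  qed
  moreover have "A \<inter> set p = {}" "B \<inter> set p = {}" "R \<subseteq> (- set p) \<times> (- set p)"
    using A_off B_off by (auto simp: R_def)
  moreover have "p \<noteq> []" "u = p ! 0" "w = p ! (length p - 1)"
    using len p0 pl by auto
  ultimately show thesis
    using dist pV AB by (intro that)
qed

text \<open>
  The set of neighbours that the shift moves is exactly the set \<open>B\<close> of the decomposition, so the
  shift replaces one star by another and leaves the remaining three parts alone.
\<close>
lemma (in pair_graph) ggs_adj_form_mono: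
  assumes ggs: "ggs_path G u P w" and nonneg: "\<And>v. 0 \<le> x v"
  obtains y where "(\<Sum>v\<in>pverts G. (y v)\<^sup>2) = (\<Sum>v\<in>pverts G. (x v)\<^sup>2)"
    and "adj_form (parcs G) x \<le> adj_form (parcs (move_neighbours G u w (fst (last P)))) y"
proof -
  define B where "B = {z. (w, z) \<in> parcs G \<and> z \<noteq> fst (last P)}"
  obtain p A R where p: "distinct p" "p \<noteq> []" "u = p ! 0" "w = p ! (length p - 1)"
    and pV: "set p \<subseteq> pverts G"
    and E: "parcs G = path_arcs p \<union> star u A \<union> star w B \<union> R"
    and disj: "A \<inter> B = {}" "A \<inter> set p = {}" "B \<inter> set p = {}"
    and R: "R \<subseteq> (- set p) \<times> (- set p)"
    by (rule ggs_path_arc_decomposition[OF ggs, folded B_def])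
  have "u \<noteq> w"
    using ggs by (simp add: ggs_path_def)
  have uw: "u \<in> set p" "w \<in> set p"
    using p by auto
  have sub: "A \<subseteq> snd ` parcs G" "B \<subseteq> snd ` parcs G" "R \<subseteq> parcs G"
    unfolding E by (force simp: star_def)+
  have fin: "finite A" "finite B" "finite R"
    using sub[THEN finite_subset] pair_finite_arcs by simp_all
  have "parcs (move_neighbours G u w (fst (last P))) = parcs G - star w B \<union> star u B"
    by (simp add: move_neighbours_def Let_def star_def B_def)
  also have "\<dots> = path_arcs p \<union> star u (A \<union> B) \<union> R"
    unfolding E using path_arcs_subset[of p] uw disj R \<open>u \<noteq> w\<close> by (auto simp: star_def)
  finally have "parcs (move_neighbours G u w (fst (last P))) = path_arcs p \<union> star u (A \<union> B) \<union> R" .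
  then show thesis
    using adj_form_slide_stars[where x = x, OF p \<open>u \<noteq> w\<close> fin disj R pair_finite_verts pV nonneg]
      that E by auto
qed

section \<open>Monotonicity of the spectral radius\<close>

lemma move_neighbours_verts: "pverts (move_neighbours G u w w') = pverts G"
  by (simp add: move_neighbours_def Let_def)

theorem theorem19:
  fixes G1 G2 :: "'a pair_pre_digraph" and n :: nat
  assumes "pair_graph G1" and "Digraph_Component.connected (with_proj G1)" and "card (pverts G1) = n"
    and "pair_graph G2" and "Digraph_Component.connected (with_proj G2)" and "card (pverts G2) = n"
    and "is_GGS G1 G2"
  shows "graph_spectral_radius G1 \<le> graph_spectral_radius G2"
proof -
  interpret G1: pair_graph G1 by fact
  interpret G2: pair_graph G2 by fact
  obtain u P w where ggs: "ggs_path G1 u P w" and G2: "G2 = move_neighbours G1 u w (fst (last P))"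
    using assms(7) unfolding is_GGS_def by blast
  have V: "pverts G2 = pverts G1"
    unfolding G2 by (rule move_neighbours_verts)
  have "u \<in> pverts G1"
    using ggs by (auto simp: ggs_path_def G1.apath_def)
  then have ne: "pverts G1 \<noteq> {}" by blast
  let ?N = "\<lambda>x. \<Sum>v\<in>pverts G1. (x v)\<^sup>2"
  obtain x where x: "\<And>v. 0 \<le> x v" "0 < ?N x"
    "graph_spectral_radius G1 * ?N x \<le> adj_form (parcs G1) x"
    using G1.spectral_radius_le_adj_form[OF ne] by blast
  obtain y where y: "?N y = ?N x" "adj_form (parcs G1) x \<le> adj_form (parcs G2) y"
    using G1.ggs_adj_form_mono[OF ggs, of x] x(1) unfolding G2 by blast
  have "graph_spectral_radius G1 * ?N x \<le> graph_spectral_radius G2 * ?N x"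
    using x(3) y G2.spectral_radius_bounds_adj_form(2)[of y] ne V by simp
  then show ?thesis
    using x(2) by simp
qed

end
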